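(* For all $1<p\le r\le s\le q<\infty$, the pair $(\ell_s\oplus_q\ell_q,\ \ell_r\oplus_p\ell_p)$ has property $(m)$, and it has the weak minimizing property.
   Context: For Banach spaces $E,F$ and $1\le p<\infty$, $E\oplus_p F$ is $E\times F$ with the norm $\|(x,y)\|=(\|x\|^p+\|y\|^p)^{1/p}$. For Banach spaces $X,Y$, $\mathcal{L}(X,Y)$ denotes the space of bounded linear operators from $X$ to $Y$, and $S_X$ the unit sphere of $X$. The minimum modulus of $T\in\mathcal{L}(X,Y)$ is $m(T)=\inf\{\|Tx\|:x\in S_X\}$; $T$ attains its minimum modulus if $\|Tx\|=m(T)$ for some $x\in S_X$. A minimizing sequence for $T$ is a sequence $(x_n)_n$ in $S_X$ with $\|Tx_n\|\to m(T)$. The pair $(X,Y)$ has the weak minimizing property (WmP) if every $T\in\mathcal{L}(X,Y)$ that admits a non-weakly null minimizing sequence (i.e. one that does not converge weakly to $0$) attains its minimum modulus. An operator $T\in\mathcal{L}(X,Y)$ satisfies property $(m)$ if for all $x\in X$, $y\in Y$ with $\|x\|\le\|y\|$ and every weakly null sequence $(x_n)_n$ in $X$, $\limsup_n\|x+x_n\|\le\limsup_n\|y+Tx_n\|$. The pair $(X,Y)$ has property $(m)$ if every $T\in\mathcal{L}(X,Y)$ with $m(T)\ge 1$ satisfies property $(m)$. *)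

theory Defs
  imports "HOL-Analysis.Analysis" "HOL-Library.Function_Algebras"
begin

text \<open>
  The spaces considered here depend on real exponents, so they cannot be types. A normed space
  over the scalar field \<open>'k\<close> is represented by a carrier inside an ambient additive group
  \<open>'a\<close>, together with a scalar multiplication and a norm, both of which are only
  meaningful on the carrier. Addition and zero are those of \<open>'a\<close>: for sequences and
  pairs they are the pointwise ones.
\<close>

record ('k, 'a) normed_space =
  ns_carrier :: "'a set"
  ns_scale :: "'k \<Rightarrow> 'a \<Rightarrow> 'a"
  ns_norm :: "'a \<Rightarrow> real"

text \<open>The first argument of \<open>lp\<close> only fixes the scalar field.\<close>

definition lp ::
  "'k itself \<Rightarrow> real \<Rightarrow> ('k::real_normed_field, nat \<Rightarrow> 'k) normed_space" where
  "lp K p =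
     \<lparr> ns_carrier = {x. summable (\<lambda>n. norm (x n) powr p)},
       ns_scale = (\<lambda>c x n. c * x n),
       ns_norm = (\<lambda>x. (\<Sum>n. norm (x n) powr p) powr (1 / p)) \<rparr>"

definition direct_sum ::
  "real \<Rightarrow> ('k, 'a) normed_space \<Rightarrow> ('k, 'b) normed_space \<Rightarrow> ('k, 'a \<times> 'b) normed_space" where
  "direct_sum p E F =
     \<lparr> ns_carrier = ns_carrier E \<times> ns_carrier F,
       ns_scale = (\<lambda>c (x, y). (ns_scale E c x, ns_scale F c y)),
       ns_norm = (\<lambda>(x, y). (ns_norm E x powr p + ns_norm F y powr p) powr (1 / p)) \<rparr>"

definition scalar_space :: "('k, 'k::real_normed_field) normed_space" where
  "scalar_space = \<lparr> ns_carrier = UNIV, ns_scale = (*), ns_norm = norm \<rparr>"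

definition unit_sphere :: "('k, 'a) normed_space \<Rightarrow> 'a set" where
  "unit_sphere X = {x \<in> ns_carrier X. ns_norm X x = 1}"

text \<open>
  An operator is a function on the ambient types; its values outside the carrier of the domain
  are irrelevant to everything below.
\<close>

definition bounded_operators ::
  "('k, 'a::ab_group_add) normed_space \<Rightarrow> ('k, 'b::ab_group_add) normed_space \<Rightarrow> ('a \<Rightarrow> 'b) set" where
  "bounded_operators X Y =
     {T. (\<forall>x\<in>ns_carrier X. T x \<in> ns_carrier Y) \<and>
         (\<forall>x\<in>ns_carrier X. \<forall>y\<in>ns_carrier X. T (x + y) = T x + T y) \<and>
         (\<forall>c. \<forall>x\<in>ns_carrier X. T (ns_scale X c x) = ns_scale Y c (T x)) \<and>
         (\<exists>C. \<forall>x\<in>ns_carrier X. ns_norm Y (T x) \<le> C * ns_norm X x)}"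

definition weakly_null ::
  "('k::real_normed_field, 'a::ab_group_add) normed_space \<Rightarrow> (nat \<Rightarrow> 'a) \<Rightarrow> bool" where
  "weakly_null X x \<longleftrightarrow>
     (\<forall>n. x n \<in> ns_carrier X) \<and>
     (\<forall>f\<in>bounded_operators X scalar_space. (\<lambda>n. f (x n)) \<longlonglongrightarrow> 0)"

definition min_modulus ::
  "('k, 'a) normed_space \<Rightarrow> ('k, 'b) normed_space \<Rightarrow> ('a \<Rightarrow> 'b) \<Rightarrow> real" where
  "min_modulus X Y T = (INF x\<in>unit_sphere X. ns_norm Y (T x))"

definition attains_min_modulus ::
  "('k, 'a) normed_space \<Rightarrow> ('k, 'b) normed_space \<Rightarrow> ('a \<Rightarrow> 'b) \<Rightarrow> bool" where
  "attains_min_modulus X Y T \<longleftrightarrow> (\<exists>x\<in>unit_sphere X. ns_norm Y (T x) = min_modulus X Y T)"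

definition minimizing_sequence ::
  "('k, 'a) normed_space \<Rightarrow> ('k, 'b) normed_space \<Rightarrow> ('a \<Rightarrow> 'b) \<Rightarrow> (nat \<Rightarrow> 'a) \<Rightarrow> bool" where
  "minimizing_sequence X Y T x \<longleftrightarrow>
     (\<forall>n. x n \<in> unit_sphere X) \<and> (\<lambda>n. ns_norm Y (T (x n))) \<longlonglongrightarrow> min_modulus X Y T"

definition weak_minimizing_property ::
  "('k::real_normed_field, 'a::ab_group_add) normed_space \<Rightarrow>
   ('k, 'b::ab_group_add) normed_space \<Rightarrow> bool" where
  "weak_minimizing_property X Y \<longleftrightarrow>
     (\<forall>T\<in>bounded_operators X Y.
        (\<exists>x. minimizing_sequence X Y T x \<and> \<not> weakly_null X x) \<longrightarrow> attains_min_modulus X Y T)"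

definition operator_property_m ::
  "('k::real_normed_field, 'a::ab_group_add) normed_space \<Rightarrow>
   ('k, 'b::ab_group_add) normed_space \<Rightarrow> ('a \<Rightarrow> 'b) \<Rightarrow> bool" where
  "operator_property_m X Y T \<longleftrightarrow>
     (\<forall>x\<in>ns_carrier X. \<forall>y\<in>ns_carrier Y. ns_norm X x \<le> ns_norm Y y \<longrightarrow>
        (\<forall>u. weakly_null X u \<longrightarrow>
           limsup (\<lambda>n. ereal (ns_norm X (x + u n)))
             \<le> limsup (\<lambda>n. ereal (ns_norm Y (y + T (u n))))))"

definition property_m ::
  "('k::real_normed_field, 'a::ab_group_add) normed_space \<Rightarrow>
   ('k, 'b::ab_group_add) normed_space \<Rightarrow> bool" where
  "property_m X Y \<longleftrightarrow>
     (\<forall>T\<in>bounded_operators X Y. min_modulus X Y T \<ge> 1 \<longrightarrow> operator_property_m X Y T)"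

end

theory Submission
  imports Defs "HOL-Complex_Analysis.Great_Picard"
begin

text \<open>
  Let \<open>X\<close> be the \<open>q\<close>-sum of \<open>l_s\<close> and \<open>l_q\<close>, and \<open>Y\<close> the \<open>p\<close>-sum of \<open>l_r\<close> and \<open>l_p\<close>. By the Brezis--Lieb
  lemma in each summand, for a bounded coordinatewise null sequence \<open>u\<close> the norm of \<open>x + u n\<close> is
  asymptotically a function of the norms of the components of \<open>x\<close> and \<open>u n\<close>. Minkowski's
  inequality with exponent \<open>q / s\<close>, respectively its reverse with exponent \<open>p / r\<close>, turns this into
  \<open>|x + u n|^s \<le> |x|^s + |u n|^s + o(1)\<close> in \<open>X\<close> and \<open>|y + v n|^r \<ge> |y|^r + |v n|^r - o(1)\<close> in \<open>Y\<close>. Since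
  \<open>r \<le> s\<close>, the two bounds combine to property \<open>(m)\<close>. A minimizing sequence for \<open>T\<close> that is not
  weakly null has a subsequence of the form \<open>z + v n\<close> with \<open>z \<noteq> 0\<close>, \<open>v\<close> weakly null and
  \<open>|v n| \<longlonglongrightarrow> d\<close>. The bounds give \<open>1 \<le> |z|^s + d^s\<close> and \<open>|T z|^r \<le> m(T)^r * (1 - d^r)\<close>, so
  \<open>|T z| \<le> m(T) * |z|\<close>, and the normalization of \<open>z\<close> attains the minimum modulus.
\<close>

section \<open>Two-dimensional Minkowski inequalities for real powers\<close>

text \<open>For positive \<open>x\<close> and \<open>y\<close> this is \<open>powr_convex\<close>.
  If one of them is 0, a single weight remains, and a weight in [0, 1] dominates its
  \<open>t\<close>-th power.\<close>

lemma powr_convex_combination: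
  fixes x y u v t :: real
  assumes "1 \<le> t" "0 \<le> x" "0 \<le> y" "0 \<le> u" "0 \<le> v" "u + v = 1"
  shows "(u * x + v * y) powr t \<le> u * x powr t + v * y powr t"
proof -
  have le: "w powr t \<le> w" if "0 \<le> w" "w \<le> 1" for w :: real
    using that assms(1) powr_mono'[of 1 t w] by (cases "w = 0") auto
  consider "x = 0" | "y = 0" | "x > 0" "y > 0"
    using assms by fastforce
  then show ?thesis
  proof cases
    case 1
    then show ?thesis
      using le[of v] assms by (simp add: powr_mult mult_right_mono)
  next
    case 2
    then show ?thesis
      using le[of u] assms by (simp add: powr_mult mult_right_mono)
  next
    case 3
    then show ?thesis
      using convex_onD[OF powr_convex[OF assms(1)], of v x y] assms
      by (simp add: eq_diff_eq[THEN iffD2, OF assms(6)])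
  qed
qed

text \<open>Split \<open>z powr t\<close> as \<open>z * z powr (t - 1)\<close>; the second factor is
  monotone because \<open>1 \<le> t\<close>.\<close>

lemma powr_superadditive:
  fixes x y t :: real
  assumes "1 \<le> t" "0 \<le> x" "0 \<le> y"
  shows "x powr t + y powr t \<le> (x + y) powr t"
proof -
  have split: "z powr t = z * z powr (t - 1)" if "0 \<le> z" for z :: real
    using that by (cases "z = 0") (simp_all add: powr_diff)
  have "x powr t + y powr t \<le> x * (x + y) powr (t - 1) + y * (x + y) powr (t - 1)"
    unfolding split[OF assms(2)] split[OF assms(3)]
    using assms by (intro add_mono mult_left_mono powr_mono2) auto
  also have "\<dots> = (x + y) powr t"
    using assms by (simp add: split[of "x + y"] distrib_right)
  finally show ?thesis .
qed

text \<open>Divide the two vectors by their norms \<open>P\<close> and \<open>Q\<close>. Their sum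
  divided by \<open>P + Q\<close> is then a convex combination of unit vectors, and convexity of the
  power applies in each coordinate.\<close>

lemma Minkowski_two_dim:
  fixes a b c d t :: real
  assumes "1 \<le> t" "0 \<le> a" "0 \<le> b" "0 \<le> c" "0 \<le> d"
  shows "((a + c) powr t + (b + d) powr t) powr (1 / t)
     \<le> (a powr t + b powr t) powr (1 / t) + (c powr t + d powr t) powr (1 / t)"
proof -
  define P where "P = (a powr t + b powr t) powr (1 / t)"
  define Q where "Q = (c powr t + d powr t) powr (1 / t)"
  have PQ: "P \<ge> 0" "Q \<ge> 0" by (simp_all add: P_def Q_def)
  have Pt: "P powr t = a powr t + b powr t" and Qt: "Q powr t = c powr t + d powr t"
    using assms by (simp_all add: P_def Q_def powr_powr)
  consider "P = 0" | "Q = 0" | "P > 0" "Q > 0"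
    using PQ by fastforce
  then show ?thesis
  proof cases
    case 1
    then have "a powr t + b powr t = 0" using Pt assms by simp
    then have "a powr t = 0" "b powr t = 0"
      by (smt (verit) powr_ge_zero)+
    then show ?thesis by simp
  next
    case 2
    then have "c powr t + d powr t = 0" using Qt assms by simp
    then have "c powr t = 0" "d powr t = 0"
      by (smt (verit) powr_ge_zero)+
    then show ?thesis by simp
  next
    case 3
    define u v where "u = P / (P + Q)" and "v = Q / (P + Q)"
    have uv: "0 \<le> u" "0 \<le> v" "u + v = 1"
      using 3 by (auto simp: u_def v_def add_divide_distrib[symmetric])
    have comb: "(e + f) powr t \<le> (P + Q) powr t * (u * (e / P) powr t + v * (f / Q) powr t)"
      if "0 \<le> e" "0 \<le> f" for e f
    proof -
      have "(P + Q) * (u * (e / P) + v * (f / Q)) = ((P + Q) * u) * (e / P) + ((P + Q) * v) * (f / Q)"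
        by (simp add: distrib_left mult.assoc)
      moreover have "(P + Q) * u = P" "(P + Q) * v = Q"
        using 3 by (simp_all add: u_def v_def)
      ultimately have "e + f = (P + Q) * (u * (e / P) + v * (f / Q))"
        using 3 by simp
      then have "(e + f) powr t = (P + Q) powr t * (u * (e / P) + v * (f / Q)) powr t"
        using 3 that uv by (simp add: powr_mult)
      also have "\<dots> \<le> (P + Q) powr t * (u * (e / P) powr t + v * (f / Q) powr t)"
        using 3 that uv assms by (intro mult_left_mono powr_convex_combination) auto
      finally show ?thesis .
    qed
    have "(a + c) powr t + (b + d) powr t
        \<le> (P + Q) powr t * (u * ((a powr t + b powr t) / P powr t)
            + v * ((c powr t + d powr t) / Q powr t))"
      using comb[of a c] comb[of b d] assms 3
      by (simp add: powr_divide algebra_simps add_divide_distrib)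
    also have "\<dots> = (P + Q) powr t"
      using 3 uv by (simp flip: Pt Qt)
    finally have "((a + c) powr t + (b + d) powr t) powr (1 / t) \<le> ((P + Q) powr t) powr (1 / t)"
      using assms by (intro powr_mono2) auto
    also have "\<dots> = P + Q" using 3 assms by (simp add: powr_powr)
    finally show ?thesis by (simp add: P_def Q_def)
  qed
qed

text \<open>Minkowski's inequality for \<open>(A, B powr (1 / t))\<close> and
  \<open>(C, D powr (1 / t))\<close>, combined with superadditivity in the second coordinate.
  \<open>B\<close> and \<open>D\<close> enter linearly because they will be masses of second
  components, with \<open>t\<close> the quotient \<open>b / a\<close> of the two exponents.\<close>

lemma mixed_Minkowski:
  fixes A B C D t :: real
  assumes "1 \<le> t" "0 \<le> A" "0 \<le> B" "0 \<le> C" "0 \<le> D"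
  shows "((A + C) powr t + (B + D)) powr (1 / t)
     \<le> (A powr t + B) powr (1 / t) + (C powr t + D) powr (1 / t)"
proof -
  let ?b = "B powr (1 / t)" and ?d = "D powr (1 / t)"
  have B: "?b powr t = B" and D: "?d powr t = D"
    using assms by (simp_all add: powr_powr)
  have "B + D \<le> (?b + ?d) powr t"
    using powr_superadditive[of t ?b ?d] assms by (simp add: B D)
  then have "((A + C) powr t + (B + D)) powr (1 / t) \<le> ((A + C) powr t + (?b + ?d) powr t) powr (1 / t)"
    using assms by (intro powr_mono2) auto
  also have "\<dots> \<le> (A powr t + B) powr (1 / t) + (C powr t + D) powr (1 / t)"
    using Minkowski_two_dim[of t A ?b C ?d] assms by (simp add: B D)
  finally show ?thesis .
qed

text \<open>This is Minkowski's inequality with exponent \<open>1 / t\<close> for the vectors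
  \<open>(A powr t, C powr t)\<close> and \<open>(B, D)\<close>.\<close>

lemma mixed_Minkowski_reverse:
  fixes A B C D t :: real
  assumes "0 < t" "t \<le> 1" "0 \<le> A" "0 \<le> B" "0 \<le> C" "0 \<le> D"
  shows "(A powr t + B) powr (1 / t) + (C powr t + D) powr (1 / t)
     \<le> ((A + C) powr t + (B + D)) powr (1 / t)"
proof -
  let ?P = "(A powr t + B) powr (1 / t) + (C powr t + D) powr (1 / t)"
  let ?T = "1 / t"
  have T: "1 \<le> ?T" using assms by simp
  have "?P powr t \<le> (A + C) powr t + (B powr ?T + D powr ?T) powr t"
    using Minkowski_two_dim[OF T, of "A powr t" "C powr t" B D] assms
    by (simp add: powr_powr)
  also have "(B powr ?T + D powr ?T) powr t \<le> ((B + D) powr ?T) powr t"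
    using assms powr_superadditive[OF T, of B D] by (intro powr_mono2) auto
  also have "\<dots> = B + D" using assms by (simp add: powr_powr)
  finally have "(?P powr t) powr ?T \<le> ((A + C) powr t + (B + D)) powr ?T"
    using assms by (intro powr_mono2) auto
  then show ?thesis using assms by (simp add: powr_powr)
qed

section \<open>Perturbation of powers and the Brezis--Lieb lemma for sequences\<close>

text \<open>Two regimes: if \<open>norm a\<close> is small against \<open>norm b\<close>, the
  quotient \<open>norm (a + b) / norm b\<close> is close to 1 and continuity of the power at 1
  yields the \<open>\<epsilon>\<close> term. Otherwise both norms are at most a fixed multiple of
  \<open>norm a\<close>, which yields the \<open>C\<close> term.\<close>

lemma powr_add_perturbation:
  fixes p \<epsilon> :: real
  assumes "0 < p" "0 < \<epsilon>"
  obtains C where "0 \<le> C"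
    "\<And>a b :: 'k::real_normed_field.
       \<bar>norm (a + b) powr p - norm b powr p\<bar> \<le> \<epsilon> * norm b powr p + C * norm a powr p"
proof -
  have "isCont (\<lambda>t::real. t powr p) 1"
    by (intro continuous_intros) auto
  then obtain \<delta> where \<delta>: "\<delta> > 0" "\<And>t::real. \<bar>t - 1\<bar> < \<delta> \<Longrightarrow> \<bar>t powr p - 1\<bar> < \<epsilon>"
    using assms(2) unfolding continuous_at_eps_delta dist_real_def by (metis powr_one_eq_one)
  define C where "C = (1 + 1 / \<delta>) powr p"
  have "\<bar>norm (a + b) powr p - norm b powr p\<bar> \<le> \<epsilon> * norm b powr p + C * norm a powr p"
    for a b :: 'k
  proof (cases "norm a < \<delta> * norm b")
    case True
    then have b: "norm b > 0" by (cases "b = 0") auto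
    have "\<bar>norm (a + b) - norm b\<bar> \<le> norm a"
      using norm_triangle_ineq3[of "a + b" b] by simp
    with True b have "\<bar>norm (a + b) / norm b - 1\<bar> < \<delta>"
      by (simp add: field_simps abs_if split: if_splits)
    from \<delta>(2)[OF this] have "\<bar>norm (a + b) powr p / norm b powr p - 1\<bar> * norm b powr p \<le> \<epsilon> * norm b powr p"
      by (intro mult_right_mono) (auto simp: powr_divide)
    moreover have "\<bar>norm (a + b) powr p / norm b powr p - 1\<bar> * norm b powr p
        = \<bar>norm (a + b) powr p - norm b powr p\<bar>"
      using b by (simp add: abs_if field_simps)
    moreover have "0 \<le> C * norm a powr p" by (simp add: C_def)
    ultimately show ?thesis by linarith
  next
    case False
    then have b: "norm b \<le> norm a / \<delta>" using \<delta>(1) by (simp add: field_simps)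
    have "norm (a + b) \<le> (1 + 1 / \<delta>) * norm a"
      using norm_triangle_ineq[of a b] b by (simp add: field_simps)
    then have 1: "norm (a + b) powr p \<le> C * norm a powr p"
      using assms \<delta>(1) unfolding C_def by (subst powr_mult[symmetric]) (auto intro!: powr_mono2)
    have "norm b \<le> (1 + 1 / \<delta>) * norm a" using b by (simp add: algebra_simps add_increasing)
    then have 2: "norm b powr p \<le> C * norm a powr p"
      using assms \<delta>(1) unfolding C_def by (subst powr_mult[symmetric]) (auto intro!: powr_mono2)
    have "0 \<le> \<epsilon> * norm b powr p" using assms by simp
    then show ?thesis using 1 2 powr_ge_zero[of "norm b" p] powr_ge_zero[of "norm (a+b)" p] by linarith
  qed
  then show thesis using that[of C] by (simp add: C_def)
qed

text \<open>The two sequences need not converge, so uniform continuity on a compact interval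
  replaces continuity at a limit. The interval \<open>{0..K + 1}\<close> leaves room for
  \<open>f n\<close>, which is eventually within 1 of \<open>g n\<close>.\<close>

lemma powr_diff_tendsto_zero:
  fixes f g :: "nat \<Rightarrow> real"
  assumes "0 < c" "(\<lambda>n. f n - g n) \<longlonglongrightarrow> 0"
    and "\<forall>\<^sub>F n in sequentially. 0 \<le> f n" "\<forall>\<^sub>F n in sequentially. 0 \<le> g n \<and> g n \<le> K"
  shows "(\<lambda>n. f n powr c - g n powr c) \<longlonglongrightarrow> 0"
proof (rule tendstoI)
  fix e :: real assume e: "0 < e"
  have "continuous_on {0..K + 1} (\<lambda>x::real. x powr c)"
    using assms(1) by (intro continuous_on_powr') (auto intro: continuous_intros)
  then have "uniformly_continuous_on {0..K + 1} (\<lambda>x::real. x powr c)"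
    by (intro compact_uniformly_continuous) auto
  then obtain d where d: "d > 0"
    "\<And>x y. x \<in> {0..K + 1} \<Longrightarrow> y \<in> {0..K + 1} \<Longrightarrow> dist y x < d \<Longrightarrow> dist (y powr c) (x powr c) < e"
    unfolding uniformly_continuous_on_def using e by meson
  have "\<forall>\<^sub>F n in sequentially. dist (f n - g n) 0 < min d 1"
    using assms(2) d(1) by (intro tendstoD) auto
  with assms(3,4) show "\<forall>\<^sub>F n in sequentially. dist (f n powr c - g n powr c) 0 < e"
  proof eventually_elim
    case (elim n)
    then have "dist (f n powr c) (g n powr c) < e"
      by (intro d(2)) (auto simp: dist_real_def)
    then show ?case by (simp add: dist_real_def)
  qed
qed

text \<open>The \<open>p\<close>-th power of the l_p norm. Without the root, the Brezis--Lieb lemma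
  is plain asymptotic additivity.\<close>

definition mass :: "real \<Rightarrow> (nat \<Rightarrow> 'k::real_normed_field) \<Rightarrow> real" where
  "mass p x = (\<Sum>n. norm (x n) powr p)"

lemma mass_nonneg:
  "summable (\<lambda>n. norm (x n) powr p) \<Longrightarrow> 0 \<le> mass p x"
  unfolding mass_def by (intro suminf_nonneg) auto

text \<open>The constant is crude, but it serves only to obtain summability and boundedness of
  sums.\<close>

lemma norm_powr_add_le:
  fixes a b :: "'a::real_normed_vector"
  assumes "0 < p"
  shows "norm (a + b) powr p \<le> 2 powr p * (norm a powr p + norm b powr p)"
proof -
  have "norm (a + b) \<le> 2 * max (norm a) (norm b)"
    using norm_triangle_ineq[of a b] by linarith
  then have "norm (a + b) powr p \<le> (2 * max (norm a) (norm b)) powr p"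
    using assms by (intro powr_mono2) auto
  also have "\<dots> = 2 powr p * max (norm a) (norm b) powr p"
    by (simp add: powr_mult)
  also have "\<dots> \<le> 2 powr p * (norm a powr p + norm b powr p)"
    by (intro mult_left_mono) (auto simp: max_def)
  finally show ?thesis .
qed

lemma summable_powr_add:
  fixes x y :: "nat \<Rightarrow> 'k::real_normed_field"
  assumes "0 < p" "summable (\<lambda>n. norm (x n) powr p)" "summable (\<lambda>n. norm (y n) powr p)"
  shows "summable (\<lambda>n. norm (x n + y n) powr p)"
proof (rule summable_comparison_test')
  show "summable (\<lambda>n. 2 powr p * (norm (x n) powr p + norm (y n) powr p))"
    by (intro summable_mult summable_add assms(2,3))
  show "norm (norm (x n + y n) powr p) \<le> 2 powr p * (norm (x n) powr p + norm (y n) powr p)" for n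
    using norm_powr_add_le[OF assms(1), of "x n" "y n"] by simp
qed

lemma mass_add_le:
  fixes x y :: "nat \<Rightarrow> 'k::real_normed_field"
  assumes "0 < p" "summable (\<lambda>n. norm (x n) powr p)" "summable (\<lambda>n. norm (y n) powr p)"
  shows "mass p (x + y) \<le> 2 powr p * (mass p x + mass p y)"
proof -
  have "mass p (x + y) \<le> (\<Sum>n. 2 powr p * (norm (x n) powr p + norm (y n) powr p))"
    unfolding mass_def plus_fun_apply
    by (intro suminf_le norm_powr_add_le summable_powr_add summable_mult summable_add assms)
  also have "\<dots> = 2 powr p * (mass p x + mass p y)"
    unfolding mass_def using assms by (simp add: suminf_mult suminf_add summable_add)
  finally show ?thesis .
qed

text \<open>The Brezis--Lieb lemma for the counting measure.\<close>

lemma mass_add_asymptotic: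
  fixes x :: "nat \<Rightarrow> 'k::real_normed_field"
  assumes p: "0 < p" and x: "summable (\<lambda>k. norm (x k) powr p)"
    and a: "\<And>n. summable (\<lambda>k. norm (a n k) powr p)"
    and bound: "\<forall>\<^sub>F n in sequentially. mass p (a n) \<le> M"
    and lim: "\<And>k. (\<lambda>n. a n k) \<longlonglongrightarrow> 0"
  shows "(\<lambda>n. mass p (x + a n) - (mass p x + mass p (a n))) \<longlonglongrightarrow> 0"
proof (rule tendstoI)
  fix e :: real assume e: "0 < e"
  \<comment> \<open>Makes the \<open>\<epsilon>\<close> term contribute at most \<open>e / 2\<close>
    as soon as \<open>mass p (a n) \<le> M\<close>.\<close>
  define \<epsilon> where "\<epsilon> = e / (2 * (\<bar>M\<bar> + 1))"
  have \<epsilon>: "\<epsilon> > 0" using e by (simp add: \<epsilon>_def)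
  obtain C where C: "0 \<le> C" "\<And>c d :: 'k.
       \<bar>norm (c + d) powr p - norm d powr p\<bar> \<le> \<epsilon> * norm d powr p + C * norm c powr p"
    using powr_add_perturbation[OF p \<epsilon>] by blast
  \<comment> \<open>\<open>g n k\<close> is the defect in coordinate \<open>k\<close>, and
    \<open>h k n\<close> its excess over the \<open>\<epsilon>\<close> term. The bound on
    \<open>g\<close> involves \<open>a n\<close>, whereas \<open>h\<close> is dominated by a
    summable sequence independent of \<open>n\<close>, so Tannery's theorem applies to it.\<close>
  define g where "g n k = norm (x k + a n k) powr p - norm (a n k) powr p - norm (x k) powr p" for n k
  define h where "h k n = max 0 (\<bar>g n k\<bar> - \<epsilon> * norm (a n k) powr p)" for k n
  have h_le: "norm (h k n) \<le> (C + 1) * norm (x k) powr p" for k n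
  proof -
    have "\<bar>g n k\<bar> \<le> \<epsilon> * norm (a n k) powr p + C * norm (x k) powr p + norm (x k) powr p"
      using C(2)[of "x k" "a n k"] powr_ge_zero[of "norm (x k)" p] unfolding g_def by linarith
    then show ?thesis using C(1) by (auto simp: h_def algebra_simps)
  qed
  have h_lim: "(\<lambda>n. h k n) \<longlonglongrightarrow> 0" for k
  proof -
    have na: "(\<lambda>n. norm (a n k) powr p) \<longlonglongrightarrow> 0 powr p"
      using p lim[of k] by (intro tendsto_powr') (auto simp: tendsto_norm_zero)
    have nx: "(\<lambda>n. norm (x k + a n k) powr p) \<longlonglongrightarrow> norm (x k) powr p"
      using p tendsto_norm[OF tendsto_add[OF tendsto_const[of "x k"] lim[of k]]]
      by (intro tendsto_powr') auto
    have "(\<lambda>n. h k n) \<longlonglongrightarrow> max 0 (\<bar>norm (x k) powr p - 0 powr p - norm (x k) powr p\<bar> - \<epsilon> * 0 powr p)"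
      unfolding h_def g_def by (intro tendsto_intros na nx)
    then show ?thesis using p by simp
  qed
  have sx: "summable (\<lambda>k. (C + 1) * norm (x k) powr p)" using x by (rule summable_mult)
  have sh: "summable (\<lambda>k. h k n)" for n
    using h_le by (intro summable_comparison_test'[OF sx, of 0]) auto
  have "\<forall>\<^sub>F (k, n) in sequentially \<times>\<^sub>F sequentially. norm (h k n) \<le> (C + 1) * norm (x k) powr p"
    using h_le by (intro always_eventually) auto
  from tannerys_theorem[OF h_lim this sx]
  have "(\<lambda>n. \<Sum>k. h k n) \<longlonglongrightarrow> (\<Sum>k::nat. 0)"
    by simp
  then have "\<forall>\<^sub>F n in sequentially. dist (\<Sum>k. h k n) 0 < e / 2"
    using e by (intro tendstoD) auto
  with bound show "\<forall>\<^sub>F n in sequentially. dist (mass p (x + a n) - (mass p x + mass p (a n))) 0 < e"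
  proof eventually_elim
    case (elim n)
    have sxa: "summable (\<lambda>k. norm (x k + a n k) powr p)"
      by (rule summable_powr_add[OF p x a])
    have "norm (\<Sum>k. g n k) \<le> (\<Sum>k. h k n + \<epsilon> * norm (a n k) powr p)"
      by (rule norm_suminf_le) (auto simp: h_def intro!: summable_add summable_mult a sh[unfolded h_def])
    also have "\<dots> = (\<Sum>k. h k n) + \<epsilon> * mass p (a n)"
      unfolding mass_def using sh a by (simp add: suminf_add[symmetric] suminf_mult summable_mult)
    also have "\<epsilon> * mass p (a n) \<le> \<epsilon> * (\<bar>M\<bar> + 1)"
      using \<epsilon> elim(1) by (intro mult_left_mono) auto
    also have "\<dots> = e / 2"
      unfolding \<epsilon>_def using abs_ge_zero[of M] by (simp add: divide_simps)
    finally have "norm (\<Sum>k. g n k) < e" using elim(2) by (simp add: dist_real_def)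
    moreover have "(\<Sum>k. g n k) = mass p (x + a n) - (mass p x + mass p (a n))"
      unfolding g_def mass_def using sxa x a
      by (simp add: suminf_diff[symmetric] summable_diff)
    ultimately show ?case by (simp add: dist_real_def)
  qed
qed

section \<open>Carrier, norm and coordinates of the direct sums\<close>

text \<open>Both spaces of the theorem have this shape: the outer exponent is that of the second
  summand, so the mass of the second component enters \<open>norm_lp_sum\<close> linearly.\<close>

abbreviation lp_sum ::
  "real \<Rightarrow> real \<Rightarrow> ('k::real_normed_field, (nat \<Rightarrow> 'k) \<times> (nat \<Rightarrow> 'k)) normed_space" where
  "lp_sum a b \<equiv> direct_sum b (lp TYPE('k) a) (lp TYPE('k) b)"

lemma carrier_lp_sum:
  "z \<in> ns_carrier (lp_sum a b) \<longleftrightarrow>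
     summable (\<lambda>n. norm (fst z n) powr a) \<and> summable (\<lambda>n. norm (snd z n) powr b)"
  by (cases z) (simp add: direct_sum_def lp_def)

lemma mass_lp_sum_nonneg:
  assumes "z \<in> ns_carrier (lp_sum a b)"
  shows "0 \<le> mass a (fst z)" "0 \<le> mass b (snd z)"
  using assms by (simp_all add: carrier_lp_sum mass_nonneg)

lemma norm_lp_sum:
  assumes "0 < b" "z \<in> ns_carrier (lp_sum a b)"
  shows "ns_norm (lp_sum a b) z = (mass a (fst z) powr (b / a) + mass b (snd z)) powr (1 / b)"
  using assms mass_lp_sum_nonneg[OF assms(2)]
  by (cases z) (simp add: direct_sum_def lp_def carrier_lp_sum powr_powr flip: mass_def)

lemma scale_lp_sum: "ns_scale (lp_sum a b) c z = (\<lambda>n. c * fst z n, \<lambda>n. c * snd z n)"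
  by (cases z) (simp add: direct_sum_def lp_def)

lemma norm_lp_sum_nonneg: "0 \<le> ns_norm (lp_sum a b) z"
  by (cases z) (simp add: direct_sum_def lp_def)

lemma norm_lp_sum_powr:
  assumes "0 < b" "z \<in> ns_carrier (lp_sum a b)"
  shows "ns_norm (lp_sum a b) z powr c = (mass a (fst z) powr (b / a) + mass b (snd z)) powr (c / b)"
  using assms by (simp add: norm_lp_sum powr_powr)

lemma norm_lp_sum_minus: "ns_norm (lp_sum a b) (- z) = ns_norm (lp_sum a b) z"
  by (cases z) (simp add: direct_sum_def lp_def)

lemma carrier_lp_sum_minus: "z \<in> ns_carrier (lp_sum a b) \<Longrightarrow> - z \<in> ns_carrier (lp_sum a b)"
  by (simp add: carrier_lp_sum)

lemma carrier_lp_sum_add: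
  assumes "0 < a" "0 < b" "y \<in> ns_carrier (lp_sum a b)" "z \<in> ns_carrier (lp_sum a b)"
  shows "y + z \<in> ns_carrier (lp_sum a b)"
  using assms by (auto simp: carrier_lp_sum plus_fun_apply intro: summable_powr_add)

lemma carrier_lp_sum_diff:
  assumes "0 < a" "0 < b" "y \<in> ns_carrier (lp_sum a b)" "z \<in> ns_carrier (lp_sum a b)"
  shows "y - z \<in> ns_carrier (lp_sum a b)"
  using carrier_lp_sum_add[OF assms(1-3) carrier_lp_sum_minus[OF assms(4)]] by simp

lemma carrier_lp_sum_scale:
  "z \<in> ns_carrier (lp_sum a b) \<Longrightarrow> ns_scale (lp_sum a b) c z \<in> ns_carrier (lp_sum a b)"
  by (auto simp: carrier_lp_sum scale_lp_sum norm_mult powr_mult intro: summable_mult)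

lemma mass_scale:
  assumes "summable (\<lambda>n. norm (x n) powr p)"
  shows "mass p (\<lambda>n. c * x n) = norm c powr p * mass p x"
  using assms by (simp add: mass_def norm_mult powr_mult suminf_mult)

lemma norm_lp_sum_scale:
  assumes "0 < a" "0 < b" "z \<in> ns_carrier (lp_sum a b)"
  shows "ns_norm (lp_sum a b) (ns_scale (lp_sum a b) c z) = norm c * ns_norm (lp_sum a b) z"
proof -
  note nn = mass_lp_sum_nonneg[OF assms(3)]
  have "ns_norm (lp_sum a b) (ns_scale (lp_sum a b) c z)
      = ((norm c powr a * mass a (fst z)) powr (b / a) + norm c powr b * mass b (snd z)) powr (1 / b)"
    using assms carrier_lp_sum_scale[OF assms(3), of c]
    by (simp add: norm_lp_sum scale_lp_sum mass_scale carrier_lp_sum)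
  also have "\<dots> = (norm c powr b * (mass a (fst z) powr (b / a) + mass b (snd z))) powr (1 / b)"
    using assms nn by (simp add: powr_mult powr_powr distrib_left)
  also have "\<dots> = norm c * ns_norm (lp_sum a b) z"
    using assms nn by (simp add: powr_mult powr_powr norm_lp_sum)
  finally show ?thesis .
qed

lemma mass_le_norm_lp_sum:
  assumes "0 < a" "0 < b" "z \<in> ns_carrier (lp_sum a b)"
  shows "mass a (fst z) \<le> ns_norm (lp_sum a b) z powr a"
    and "mass b (snd z) \<le> ns_norm (lp_sum a b) z powr b"
proof -
  note nn = mass_lp_sum_nonneg[OF assms(3)]
  have "mass a (fst z) = (mass a (fst z) powr (b / a)) powr (a / b)"
    using assms nn by (simp add: powr_powr)
  also have "\<dots> \<le> ns_norm (lp_sum a b) z powr a"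
    unfolding norm_lp_sum_powr[OF assms(2,3)] using assms nn by (intro powr_mono2) auto
  finally show "mass a (fst z) \<le> ns_norm (lp_sum a b) z powr a" .
  show "mass b (snd z) \<le> ns_norm (lp_sum a b) z powr b"
    unfolding norm_lp_sum_powr[OF assms(2,3)] using assms nn by simp
qed

lemma mass_le_powr_of_norm_le:
  assumes "0 < a" "0 < b" "z \<in> ns_carrier (lp_sum a b)" "ns_norm (lp_sum a b) z \<le> M"
  shows "mass a (fst z) \<le> M powr a" and "mass b (snd z) \<le> M powr b"
proof -
  have "ns_norm (lp_sum a b) z powr c \<le> M powr c" if "0 < c" for c
    using that assms(4) by (intro powr_mono2 norm_lp_sum_nonneg) auto
  then show "mass a (fst z) \<le> M powr a" and "mass b (snd z) \<le> M powr b"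
    using mass_le_norm_lp_sum[OF assms(1-3)] assms(1,2) order_trans by blast+
qed

lemma norm_nth_le_mass:
  assumes "summable (\<lambda>n. norm (x n) powr p)"
  shows "norm (x k) powr p \<le> mass p x"
  unfolding mass_def using assms sum_le_suminf[of _ "{k}"] by fastforce

lemma norm_nth_le_norm_lp_sum:
  assumes "0 < a" "0 < b" "z \<in> ns_carrier (lp_sum a b)"
  shows "norm (fst z k) \<le> ns_norm (lp_sum a b) z" "norm (snd z k) \<le> ns_norm (lp_sum a b) z"
proof -
  have "norm (fst z k) powr a \<le> ns_norm (lp_sum a b) z powr a"
    using norm_nth_le_mass[of "fst z" a k] mass_le_norm_lp_sum[OF assms] assms
    by (auto simp: carrier_lp_sum)
  then show "norm (fst z k) \<le> ns_norm (lp_sum a b) z"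
    using assms norm_lp_sum_nonneg powr_less_mono2 by (meson linorder_not_le)
  have "norm (snd z k) powr b \<le> ns_norm (lp_sum a b) z powr b"
    using norm_nth_le_mass[of "snd z" b k] mass_le_norm_lp_sum[OF assms] assms
    by (auto simp: carrier_lp_sum)
  then show "norm (snd z k) \<le> ns_norm (lp_sum a b) z"
    using assms norm_lp_sum_nonneg powr_less_mono2 by (meson linorder_not_le)
qed

text \<open>A weak substitute for the triangle inequality: the mass of a sum is controlled by
  \<open>mass_add_le\<close>, and a bound depending only on \<open>a\<close>, \<open>b\<close> and
  \<open>R\<close> is enough for its uses.\<close>

lemma norm_lp_sum_add_bounded:
  assumes "0 < a" "0 < b"
  obtains K where
    "\<And>y z :: (nat \<Rightarrow> 'k::real_normed_field) \<times> (nat \<Rightarrow> 'k).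
       y \<in> ns_carrier (lp_sum a b) \<Longrightarrow> z \<in> ns_carrier (lp_sum a b) \<Longrightarrow>
       ns_norm (lp_sum a b) y \<le> R \<Longrightarrow> ns_norm (lp_sum a b) z \<le> R \<Longrightarrow>
       ns_norm (lp_sum a b) (y + z) \<le> K"
proof
  fix y z :: "(nat \<Rightarrow> 'k) \<times> (nat \<Rightarrow> 'k)"
  assume y: "y \<in> ns_carrier (lp_sum a b)" and z: "z \<in> ns_carrier (lp_sum a b)"
    and R: "ns_norm (lp_sum a b) y \<le> R" "ns_norm (lp_sum a b) z \<le> R"
  have yz: "y + z \<in> ns_carrier (lp_sum a b)"
    by (rule carrier_lp_sum_add[OF assms y z])
  have "mass a (fst (y + z)) \<le> 2 powr a * (mass a (fst y) + mass a (fst z))"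
    using mass_add_le[of a "fst y" "fst z"] assms y z by (simp add: carrier_lp_sum)
  also have "\<dots> \<le> 2 powr a * (R powr a + R powr a)"
    by (intro mult_left_mono add_mono mass_le_powr_of_norm_le(1)[OF assms] y z R) simp
  finally have 1: "mass a (fst (y + z)) \<le> 2 powr a * (R powr a + R powr a)" .
  have "mass b (snd (y + z)) \<le> 2 powr b * (mass b (snd y) + mass b (snd z))"
    using mass_add_le[of b "snd y" "snd z"] assms y z by (simp add: carrier_lp_sum)
  also have "\<dots> \<le> 2 powr b * (R powr b + R powr b)"
    by (intro mult_left_mono add_mono mass_le_powr_of_norm_le(2)[OF assms] y z R) simp
  finally have 2: "mass b (snd (y + z)) \<le> 2 powr b * (R powr b + R powr b)" .
  note nn = mass_lp_sum_nonneg[OF yz]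
  show "ns_norm (lp_sum a b) (y + z)
     \<le> ((2 powr a * (R powr a + R powr a)) powr (b / a) + 2 powr b * (R powr b + R powr b)) powr (1 / b)"
    unfolding norm_lp_sum[OF assms(2) yz] using 1 2 nn assms
    by (intro powr_mono2 add_mono) auto
qed

section \<open>Asymptotics of the norm along coordinatewise null sequences\<close>

text \<open>A concrete stand-in for weak convergence to 0, and the form of it that the Brezis--Lieb
  lemma requires. For bounded sequences in \<open>lp_sum a b\<close> with \<open>1 < a\<close> and
  \<open>a \<le> b\<close> the two notions turn out to agree.\<close>

definition coordinatewise_null ::
  "(nat \<Rightarrow> (nat \<Rightarrow> 'k::real_normed_field) \<times> (nat \<Rightarrow> 'k)) \<Rightarrow> bool" where
  "coordinatewise_null u \<longleftrightarrow>
     (\<forall>k. (\<lambda>n. fst (u n) k) \<longlonglongrightarrow> 0) \<and> (\<forall>k. (\<lambda>n. snd (u n) k) \<longlonglongrightarrow> 0)"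

text \<open>Brezis--Lieb in each summand gives additivity of masses up to o(1);
  \<open>powr_diff_tendsto_zero\<close> carries this error through the power \<open>b / a\<close>
  and then through \<open>a / b\<close>. Raising the norm to the power \<open>a\<close> produces the
  shape of the mixed Minkowski inequalities.\<close>

lemma norm_lp_sum_add_asymptotic:
  fixes x :: "(nat \<Rightarrow> 'k::real_normed_field) \<times> (nat \<Rightarrow> 'k)"
  assumes a: "0 < a" and b: "0 < b" and x: "x \<in> ns_carrier (lp_sum a b)"
    and u: "\<And>n. u n \<in> ns_carrier (lp_sum a b)"
    and bound: "\<forall>\<^sub>F n in sequentially. ns_norm (lp_sum a b) (u n) \<le> M"
    and null: "coordinatewise_null u"
  shows "(\<lambda>n. ns_norm (lp_sum a b) (x + u n) powr a
            - ((mass a (fst x) + mass a (fst (u n))) powr (b / a)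
               + (mass b (snd x) + mass b (snd (u n)))) powr (a / b)) \<longlonglongrightarrow> 0"
proof -
  note nn = mass_lp_sum_nonneg
  have xu: "x + u n \<in> ns_carrier (lp_sum a b)" for n
    by (rule carrier_lp_sum_add[OF a b x u])
  have Ma: "\<forall>\<^sub>F n in sequentially. mass a (fst (u n)) \<le> M powr a"
    using bound by eventually_elim (rule mass_le_powr_of_norm_le(1)[OF a b u])
  have Mb: "\<forall>\<^sub>F n in sequentially. mass b (snd (u n)) \<le> M powr b"
    using bound by eventually_elim (rule mass_le_powr_of_norm_le(2)[OF a b u])
  have 1: "(\<lambda>n. mass a (fst (x + u n)) - (mass a (fst x) + mass a (fst (u n)))) \<longlonglongrightarrow> 0"
    using mass_add_asymptotic[OF a, of "fst x" "\<lambda>n. fst (u n)"] x u Ma null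
    by (simp add: carrier_lp_sum coordinatewise_null_def)
  have 2: "(\<lambda>n. mass b (snd (x + u n)) - (mass b (snd x) + mass b (snd (u n)))) \<longlonglongrightarrow> 0"
    using mass_add_asymptotic[OF b, of "snd x" "\<lambda>n. snd (u n)"] x u Mb null
    by (simp add: carrier_lp_sum coordinatewise_null_def)
  have "(\<lambda>n. mass a (fst (x + u n)) powr (b / a)
      - (mass a (fst x) + mass a (fst (u n))) powr (b / a)) \<longlonglongrightarrow> 0"
  proof (rule powr_diff_tendsto_zero[OF _ 1])
    show "\<forall>\<^sub>F n in sequentially. 0 \<le> mass a (fst x) + mass a (fst (u n)) \<and>
        mass a (fst x) + mass a (fst (u n)) \<le> mass a (fst x) + M powr a"
      using Ma by eventually_elim (use nn[OF x] nn[OF u] in auto)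
  qed (use a b nn[OF xu] in auto)
  from tendsto_add[OF this 2]
  have 3: "(\<lambda>n. (mass a (fst (x + u n)) powr (b / a) + mass b (snd (x + u n)))
      - ((mass a (fst x) + mass a (fst (u n))) powr (b / a)
         + (mass b (snd x) + mass b (snd (u n))))) \<longlonglongrightarrow> 0"
    by (simp add: algebra_simps)
  have "(\<lambda>n. (mass a (fst (x + u n)) powr (b / a) + mass b (snd (x + u n))) powr (a / b)
      - ((mass a (fst x) + mass a (fst (u n))) powr (b / a)
         + (mass b (snd x) + mass b (snd (u n)))) powr (a / b)) \<longlonglongrightarrow> 0"
  proof (rule powr_diff_tendsto_zero[OF _ 3])
    show "\<forall>\<^sub>F n in sequentially.
        0 \<le> (mass a (fst x) + mass a (fst (u n))) powr (b / a) + (mass b (snd x) + mass b (snd (u n))) \<and>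
        (mass a (fst x) + mass a (fst (u n))) powr (b / a) + (mass b (snd x) + mass b (snd (u n)))
        \<le> (mass a (fst x) + M powr a) powr (b / a) + (mass b (snd x) + M powr b)"
      using Ma Mb
    proof eventually_elim
      case (elim n)
      then show ?case
        using nn[OF x] nn[OF u[of n]] a b by (auto intro!: add_mono powr_mono2)
    qed
  qed (use a b nn[OF xu] in auto)
  then show ?thesis by (simp add: norm_lp_sum_powr[OF b xu])
qed

text \<open>Here \<open>b / a\<close> is at least 1, so \<open>mixed_Minkowski\<close> bounds the
  asymptotic expression from above. This is the estimate for the domain space.\<close>

lemma norm_lp_sum_add_eventually_le:
  assumes a: "0 < a" and ab: "a \<le> b" and x: "x \<in> ns_carrier (lp_sum a b)"
    and u: "\<And>n. u n \<in> ns_carrier (lp_sum a b)"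
    and bound: "\<forall>\<^sub>F n in sequentially. ns_norm (lp_sum a b) (u n) \<le> M"
    and null: "coordinatewise_null u" and e: "0 < e"
  shows "\<forall>\<^sub>F n in sequentially. ns_norm (lp_sum a b) (x + u n) powr a
           \<le> ns_norm (lp_sum a b) x powr a + ns_norm (lp_sum a b) (u n) powr a + e"
proof -
  have b: "0 < b" using a ab by simp
  note nn = mass_lp_sum_nonneg
  from tendstoD[OF norm_lp_sum_add_asymptotic[OF a b x u bound null] e]
  show ?thesis
  proof eventually_elim
    case (elim n)
    have "((mass a (fst x) + mass a (fst (u n))) powr (b / a)
               + (mass b (snd x) + mass b (snd (u n)))) powr (a / b)
        \<le> ns_norm (lp_sum a b) x powr a + ns_norm (lp_sum a b) (u n) powr a"
      using mixed_Minkowski[of "b / a" "mass a (fst x)" "mass b (snd x)" "mass a (fst (u n))" "mass b (snd (u n))"]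
        nn[OF x] nn[OF u[of n]] a ab norm_lp_sum_powr[OF b x] norm_lp_sum_powr[OF b u[of n]] by simp
    with elim show ?case unfolding dist_real_def by linarith
  qed
qed

text \<open>Here \<open>b / a\<close> is at most 1 and the Minkowski inequality reverses. This is
  the estimate for the target space.\<close>

lemma norm_lp_sum_add_eventually_ge:
  assumes b: "0 < b" and ba: "b \<le> a" and x: "x \<in> ns_carrier (lp_sum a b)"
    and u: "\<And>n. u n \<in> ns_carrier (lp_sum a b)"
    and bound: "\<forall>\<^sub>F n in sequentially. ns_norm (lp_sum a b) (u n) \<le> M"
    and null: "coordinatewise_null u" and e: "0 < e"
  shows "\<forall>\<^sub>F n in sequentially. ns_norm (lp_sum a b) x powr a + ns_norm (lp_sum a b) (u n) powr a
           \<le> ns_norm (lp_sum a b) (x + u n) powr a + e"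
proof -
  have a: "0 < a" using b ba by simp
  note nn = mass_lp_sum_nonneg
  from tendstoD[OF norm_lp_sum_add_asymptotic[OF a b x u bound null] e]
  show ?thesis
  proof eventually_elim
    case (elim n)
    have "ns_norm (lp_sum a b) x powr a + ns_norm (lp_sum a b) (u n) powr a
        \<le> ((mass a (fst x) + mass a (fst (u n))) powr (b / a)
               + (mass b (snd x) + mass b (snd (u n)))) powr (a / b)"
      using mixed_Minkowski_reverse[of "b / a" "mass a (fst x)" "mass b (snd x)" "mass a (fst (u n))" "mass b (snd (u n))"]
        nn[OF x] nn[OF u[of n]] b ba norm_lp_sum_powr[OF b x] norm_lp_sum_powr[OF b u[of n]] by simp
    with elim show ?case unfolding dist_real_def by linarith
  qed
qed

section \<open>Weakly null versus coordinatewise null sequences\<close>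

lemma le_powr_inverse:
  fixes x y c :: real
  assumes "0 < c" "0 \<le> x" "x powr c \<le> y"
  shows "x \<le> y powr (1 / c)"
proof -
  have "(x powr c) powr (1 / c) \<le> y powr (1 / c)"
    using assms by (intro powr_mono2) auto
  then show ?thesis using assms by (simp add: powr_powr)
qed

lemma bounded_operatorsD:
  assumes "T \<in> bounded_operators X Y"
  shows "x \<in> ns_carrier X \<Longrightarrow> T x \<in> ns_carrier Y"
    and "x \<in> ns_carrier X \<Longrightarrow> y \<in> ns_carrier X \<Longrightarrow> T (x + y) = T x + T y"
    and "x \<in> ns_carrier X \<Longrightarrow> T (ns_scale X c x) = ns_scale Y c (T x)"
    and "\<exists>C. \<forall>x\<in>ns_carrier X. ns_norm Y (T x) \<le> C * ns_norm X x"
  using assms by (auto simp: bounded_operators_def)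

lemma coordinatewise_null_scale:
  assumes "coordinatewise_null u" "\<And>n. norm (c n) = 1"
  shows "coordinatewise_null (\<lambda>n. ns_scale (lp_sum a b) (c n) (u n))"
  using assms unfolding coordinatewise_null_def scale_lp_sum
  by (subst (1 2) tendsto_norm_zero_iff[symmetric]) (simp add: norm_mult tendsto_norm_zero_iff)

text \<open>If \<open>f (u n)\<close> stayed away from \<open>0\<close>, then adding up \<open>N\<close> suitably rotated and sparse terms of
  \<open>u\<close> would produce a vector of norm \<open>O(N powr (1 / a))\<close> on which \<open>f\<close> is at least \<open>N * \<epsilon>\<close>.\<close>

lemma coordinatewise_null_bounded_functional:
  fixes u :: "nat \<Rightarrow> (nat \<Rightarrow> 'k::real_normed_field) \<times> (nat \<Rightarrow> 'k)"
  assumes a: "1 < a" and ab: "a \<le> b"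
    and u: "\<And>n. u n \<in> ns_carrier (lp_sum a b)"
    and bound: "\<forall>\<^sub>F n in sequentially. ns_norm (lp_sum a b) (u n) \<le> M"
    and null: "coordinatewise_null u"
    and f: "f \<in> bounded_operators (lp_sum a b) scalar_space"
  shows "(\<lambda>n. f (u n)) \<longlonglongrightarrow> 0"
proof (rule ccontr)
  assume "\<not> ?thesis"
  then obtain \<epsilon> where \<epsilon>: "\<epsilon> > 0" and freq: "\<exists>\<^sub>F n in sequentially. \<epsilon> \<le> norm (f (u n))"
    unfolding tendsto_iff by (auto simp: not_eventually not_less)
  have pos: "0 < a" "0 < b" using a ab by auto
  \<comment> \<open>Rotating by \<open>c n\<close> makes the values of \<open>f\<close> nonnegative
    reals, so that they add up without cancellation. The value 1 where \<open>f (u n)\<close>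
    vanishes keeps \<open>c n\<close> unimodular.\<close>
  define c where "c n = (if f (u n) = 0 then 1 else of_real (norm (f (u n))) / f (u n))" for n
  have norm_c: "norm (c n) = 1" for n
    by (simp add: c_def norm_divide)
  have c_mult: "c n * f (u n) = of_real (norm (f (u n)))" for n
    by (simp add: c_def)
  define v where "v n = ns_scale (lp_sum a b) (c n) (u n)" for n
  have v: "v n \<in> ns_carrier (lp_sum a b)" for n
    unfolding v_def by (rule carrier_lp_sum_scale[OF u])
  have norm_v: "ns_norm (lp_sum a b) (v n) = ns_norm (lp_sum a b) (u n)" for n
    unfolding v_def norm_lp_sum_scale[OF pos u] norm_c by simp
  have null_v: "coordinatewise_null v"
    unfolding v_def by (rule coordinatewise_null_scale[OF null norm_c])
  have bound_v: "\<forall>\<^sub>F n in sequentially. ns_norm (lp_sum a b) (v n) \<le> M"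
    using bound by (simp add: norm_v)
  have f_v: "f (v n) = of_real (norm (f (u n)))" for n
    unfolding v_def bounded_operatorsD(3)[OF f u] by (simp add: scalar_space_def c_mult)
  \<comment> \<open>Each added term raises the \<open>a\<close>-th power of the norm by at most
    \<open>M powr a\<close>, plus an error that is allowed to be 1.\<close>
  define K where "K = M powr a + 1"
  \<comment> \<open>In the induction step the new index is taken so late that the asymptotic bound
    holds against the vector \<open>x\<close> already built; \<open>f\<close> is large at infinitely
    many indices, so such a choice exists.\<close>
  have step: "\<exists>x\<in>ns_carrier (lp_sum a b). ns_norm (lp_sum a b) x powr a \<le> real N * K
      \<and> (\<exists>t\<ge>real N * \<epsilon>. f x = of_real t)" for N
  proof (induction N)
    case 0
    have "(0 :: (nat \<Rightarrow> 'k) \<times> (nat \<Rightarrow> 'k)) \<in> ns_carrier (lp_sum a b)"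
      by (simp add: carrier_lp_sum)
    moreover have "ns_norm (lp_sum a b) (0 :: (nat \<Rightarrow> 'k) \<times> (nat \<Rightarrow> 'k)) = 0"
      using norm_lp_sum[OF pos(2) calculation] by (simp add: mass_def)
    moreover have "f 0 = 0"
      using bounded_operatorsD(2)[OF f calculation(1) calculation(1)] by simp
    ultimately show ?case by (intro bexI[of _ 0]) auto
  next
    case (Suc N)
    then obtain x t where x: "x \<in> ns_carrier (lp_sum a b)"
      "ns_norm (lp_sum a b) x powr a \<le> real N * K" "real N * \<epsilon> \<le> t" "f x = of_real t"
      by blast
    have "\<forall>\<^sub>F n in sequentially. ns_norm (lp_sum a b) (x + v n) powr a
         \<le> ns_norm (lp_sum a b) x powr a + ns_norm (lp_sum a b) (v n) powr a + 1"
      by (rule norm_lp_sum_add_eventually_le[OF pos(1) ab x(1) v bound_v null_v]) simp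
    with bound_v have "\<exists>\<^sub>F n in sequentially. \<epsilon> \<le> norm (f (u n))
        \<and> ns_norm (lp_sum a b) (v n) \<le> M \<and> ns_norm (lp_sum a b) (x + v n) powr a
         \<le> ns_norm (lp_sum a b) x powr a + ns_norm (lp_sum a b) (v n) powr a + 1"
      by (intro frequently_eventually_frequently[OF freq] eventually_conj)
    then obtain n where n: "\<epsilon> \<le> norm (f (u n))" "ns_norm (lp_sum a b) (v n) \<le> M"
      "ns_norm (lp_sum a b) (x + v n) powr a
         \<le> ns_norm (lp_sum a b) x powr a + ns_norm (lp_sum a b) (v n) powr a + 1"
      by (auto dest: frequently_ex)
    have "ns_norm (lp_sum a b) (v n) powr a \<le> M powr a"
      using n(2) pos by (intro powr_mono2 norm_lp_sum_nonneg) auto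
    then have "ns_norm (lp_sum a b) (x + v n) powr a \<le> real (Suc N) * K"
      using n(3) x(2) by (simp add: K_def algebra_simps)
    moreover have "f (x + v n) = of_real (t + norm (f (u n)))"
      using x(4) f_v[of n] bounded_operatorsD(2)[OF f x(1) v] by simp
    moreover have "real (Suc N) * \<epsilon> \<le> t + norm (f (u n))"
      using n(1) x(3) by (simp add: algebra_simps)
    ultimately show ?case using carrier_lp_sum_add[OF pos x(1) v] by blast
  qed
  obtain C where C: "\<And>x. x \<in> ns_carrier (lp_sum a b) \<Longrightarrow> norm (f x) \<le> C * ns_norm (lp_sum a b) x"
    using bounded_operatorsD(4)[OF f] by (auto simp: scalar_space_def)
  have K: "K > 0" by (simp add: K_def add_nonneg_pos)
  define D where "D = \<bar>C\<bar> * K powr (1 / a) / \<epsilon>"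
  have le: "real N \<le> D * real N powr (1 / a)" for N
  proof -
    obtain x t where x: "x \<in> ns_carrier (lp_sum a b)"
      "ns_norm (lp_sum a b) x powr a \<le> real N * K" "real N * \<epsilon> \<le> t" "f x = of_real t"
      using step[of N] by blast
    have "ns_norm (lp_sum a b) x \<le> (real N * K) powr (1 / a)"
      by (rule le_powr_inverse[OF pos(1) norm_lp_sum_nonneg x(2)])
    then have "ns_norm (lp_sum a b) x \<le> real N powr (1 / a) * K powr (1 / a)"
      using K by (simp add: powr_mult)
    then have "C * ns_norm (lp_sum a b) x \<le> \<bar>C\<bar> * (real N powr (1 / a) * K powr (1 / a))"
      by (intro mult_mono) (auto intro: norm_lp_sum_nonneg)
    moreover have "real N * \<epsilon> \<le> norm (f x)" using x(3) by (simp add: x(4))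
    ultimately show ?thesis using C[OF x(1)] \<epsilon> by (simp add: D_def field_simps)
  qed
  \<comment> \<open>Since \<open>1 < a\<close>, the power \<open>real N powr \<theta>\<close> is
    unbounded in \<open>N\<close>, which contradicts the linear lower bound recorded in
    \<open>le\<close>.\<close>
  define \<theta> where "\<theta> = 1 - 1 / a"
  have \<theta>: "\<theta> > 0" using a by (simp add: \<theta>_def)
  obtain N :: nat where N: "(\<bar>D\<bar> + 1) powr (1 / \<theta>) < real N"
    using reals_Archimedean2 by blast
  have N0: "0 < real N" by (rule le_less_trans[OF powr_ge_zero N])
  have "\<bar>D\<bar> + 1 = ((\<bar>D\<bar> + 1) powr (1 / \<theta>)) powr \<theta>"
    using \<theta> by (simp add: powr_powr)
  also have "\<dots> < real N powr \<theta>" using N \<theta> by (intro powr_less_mono2) auto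
  also have "\<dots> = real N / real N powr (1 / a)" using N0 by (simp add: \<theta>_def powr_diff)
  also have "\<dots> \<le> D" using le[of N] N0 by (simp add: field_simps)
  finally show False by simp
qed

text \<open>Each coordinate of \<open>T x\<close> is a bounded functional of \<open>x\<close>.
  Taking \<open>T\<close> to be the identity gives the claim for \<open>u\<close> itself.\<close>

lemma weakly_null_coordinatewise_null:
  assumes "0 < a" "0 < b" and T: "T \<in> bounded_operators X (lp_sum a b)" and u: "weakly_null X u"
  shows "coordinatewise_null (\<lambda>n. T (u n))"
proof -
  obtain C where C: "\<And>x. x \<in> ns_carrier X \<Longrightarrow> ns_norm (lp_sum a b) (T x) \<le> C * ns_norm X x"
    using bounded_operatorsD(4)[OF T] by blast
  have fst: "norm (fst (T x) k) \<le> C * ns_norm X x" and snd: "norm (snd (T x) k) \<le> C * ns_norm X x"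
    if "x \<in> ns_carrier X" for x k
    using norm_nth_le_norm_lp_sum[OF assms(1,2) bounded_operatorsD(1)[OF T that], of k] C[OF that]
    by linarith+
  have functional: "g \<in> bounded_operators X scalar_space"
    if "\<And>x y. x \<in> ns_carrier X \<Longrightarrow> y \<in> ns_carrier X \<Longrightarrow> g (x + y) = g x + g y"
      "\<And>c x. x \<in> ns_carrier X \<Longrightarrow> g (ns_scale X c x) = c * g x"
      "\<And>x. x \<in> ns_carrier X \<Longrightarrow> norm (g x) \<le> C * ns_norm X x" for g
    unfolding bounded_operators_def scalar_space_def normed_space.simps
    by (intro CollectI conjI ballI allI exI[of _ C] that UNIV_I)
  have lim: "(\<lambda>n. g (u n)) \<longlonglongrightarrow> 0" if "g \<in> bounded_operators X scalar_space" for g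
    using u that by (simp add: weakly_null_def)
  have "(\<lambda>x. fst (T x) k) \<in> bounded_operators X scalar_space" for k
    by (rule functional)
      (simp_all only: bounded_operatorsD(2,3)[OF T] fst fst_add plus_fun_apply scale_lp_sum prod.sel)
  note fst_lim = lim[OF this]
  have "(\<lambda>x. snd (T x) k) \<in> bounded_operators X scalar_space" for k
    by (rule functional)
      (simp_all only: bounded_operatorsD(2,3)[OF T] snd snd_add plus_fun_apply scale_lp_sum prod.sel)
  note snd_lim = lim[OF this]
  show ?thesis
    unfolding coordinatewise_null_def using fst_lim snd_lim by simp
qed

lemma id_bounded_operator: "(\<lambda>x. x) \<in> bounded_operators X X"
  unfolding bounded_operators_def by (intro CollectI conjI exI[of _ 1]) simp_all

section \<open>Coordinatewise convergent subsequences\<close>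

text \<open>As in Fatou's lemma, the bound \<open>B\<close> passes to the limit in every finite
  partial sum.\<close>

lemma summable_powr_coordinatewise_limit:
  fixes w :: "nat \<Rightarrow> nat \<Rightarrow> 'k::real_normed_field"
  assumes p: "0 < p" and w: "\<And>n. summable (\<lambda>k. norm (w n k) powr p)" "\<And>n. mass p (w n) \<le> B"
    and lim: "\<And>k. (\<lambda>n. w n k) \<longlonglongrightarrow> y k"
  shows "summable (\<lambda>k. norm (y k) powr p)"
proof (rule bounded_imp_summable)
  show "0 \<le> norm (y k) powr p" for k by simp
  fix N
  have "(\<lambda>n. \<Sum>k\<le>N. norm (w n k) powr p) \<longlonglongrightarrow> (\<Sum>k\<le>N. norm (y k) powr p)"
    using p by (intro tendsto_sum tendsto_powr' tendsto_norm tendsto_const lim) auto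
  moreover have "(\<Sum>k\<le>N. norm (w n k) powr p) \<le> B" for n
    using sum_le_suminf[OF w(1)[of n], of "{..N}"] w(2)[of n] by (simp add: mass_def)
  ultimately show "(\<Sum>k\<le>N. norm (y k) powr p) \<le> B"
    by (meson LIMSEQ_le_const2)
qed

lemma bounded_imp_coordinatewise_convergent_subsequence:
  fixes u :: "nat \<Rightarrow> (nat \<Rightarrow> 'k::{real_normed_field,heine_borel}) \<times> (nat \<Rightarrow> 'k)"
  assumes a: "0 < a" and b: "0 < b"
    and u: "\<And>n. u n \<in> ns_carrier (lp_sum a b)"
    and bound: "\<And>n. ns_norm (lp_sum a b) (u n) \<le> M"
  obtains \<sigma> z where "strict_mono \<sigma>" "z \<in> ns_carrier (lp_sum a b)"
    "coordinatewise_null (\<lambda>n. u (\<sigma> n) - z)"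
proof -
  \<comment> \<open>Both components form one family over the countable index set
    \<open>bool \<times> nat\<close>, so a single diagonal extraction suffices.\<close>
  define g where "g n i = (if fst i then fst (u n) (snd i) else snd (u n) (snd i))"
    for n and i :: "bool \<times> nat"
  have "norm (g n i) \<le> M" for n i
    unfolding g_def using norm_nth_le_norm_lp_sum[OF a b u[of n], THEN order_trans, OF bound] by simp
  note norm_g = this
  obtain \<sigma> where \<sigma>: "strict_mono (\<sigma> :: nat \<Rightarrow> nat)"
    and conv: "\<And>i. i \<in> UNIV \<Longrightarrow> \<exists>l. (\<lambda>n. g (\<sigma> n) i) \<longlonglongrightarrow> l"
    by (rule function_convergent_subsequence[of UNIV g M]) (simp_all add: norm_g)
  obtain l where l: "\<And>i. (\<lambda>n. g (\<sigma> n) i) \<longlonglongrightarrow> l i"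
    using conv[OF UNIV_I] by metis
  define z where "z = (\<lambda>k. l (True, k), \<lambda>k. l (False, k))"
  have lim: "(\<lambda>n. fst (u (\<sigma> n)) k) \<longlonglongrightarrow> fst z k" "(\<lambda>n. snd (u (\<sigma> n)) k) \<longlonglongrightarrow> snd z k" for k
    using l[of "(True, k)"] l[of "(False, k)"] by (simp_all add: g_def z_def)
  have "mass a (fst (u n)) \<le> M powr a" "mass b (snd (u n)) \<le> M powr b" for n
    by (rule mass_le_powr_of_norm_le[OF a b u bound])+
  note mass = this
  have summ: "summable (\<lambda>k. norm (fst (u n) k) powr a)" "summable (\<lambda>k. norm (snd (u n) k) powr b)" for n
    using u[of n] by (simp_all add: carrier_lp_sum)
  have "z \<in> ns_carrier (lp_sum a b)"
    unfolding carrier_lp_sum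
    using summable_powr_coordinatewise_limit[of a "\<lambda>n. fst (u (\<sigma> n))", OF a summ(1) mass(1) lim(1)]
      summable_powr_coordinatewise_limit[of b "\<lambda>n. snd (u (\<sigma> n))", OF b summ(2) mass(2) lim(2)]
    by (rule conjI)
  moreover have "coordinatewise_null (\<lambda>n. u (\<sigma> n) - z)"
    using lim by (simp add: coordinatewise_null_def LIM_zero)
  ultimately show thesis using that \<sigma> by blast
qed

section \<open>Minimum modulus and normalization\<close>

lemma min_modulus_le_norm:
  assumes "x \<in> unit_sphere (lp_sum a b)"
  shows "min_modulus (lp_sum a b) (lp_sum a' b') T \<le> ns_norm (lp_sum a' b') (T x)"
  unfolding min_modulus_def using assms
  by (rule cINF_lower[rotated]) (rule bdd_belowI2[of _ 0], rule norm_lp_sum_nonneg)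

lemma normalize_lp_sum:
  assumes "0 < a" "0 < b" "x \<in> ns_carrier (lp_sum a b)" "ns_norm (lp_sum a b) x \<noteq> 0"
  shows "ns_scale (lp_sum a b) (of_real (1 / ns_norm (lp_sum a b) x)) x \<in> unit_sphere (lp_sum a b)"
  unfolding unit_sphere_def
proof (rule CollectI, rule conjI)
  show "ns_scale (lp_sum a b) (of_real (1 / ns_norm (lp_sum a b) x)) x \<in> ns_carrier (lp_sum a b)"
    by (rule carrier_lp_sum_scale[OF assms(3)])
  show "ns_norm (lp_sum a b) (ns_scale (lp_sum a b) (of_real (1 / ns_norm (lp_sum a b) x)) x) = 1"
    unfolding norm_lp_sum_scale[OF assms(1-3)] norm_of_real
    using assms(4) norm_lp_sum_nonneg[of b a x] by simp
qed

lemma norm_image_normalize_lp_sum: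
  assumes "0 < a'" "0 < b'"
    and T: "T \<in> bounded_operators (lp_sum a b) (lp_sum a' b')" and x: "x \<in> ns_carrier (lp_sum a b)"
  shows "ns_norm (lp_sum a' b') (T (ns_scale (lp_sum a b) (of_real (1 / ns_norm (lp_sum a b) x)) x))
    = ns_norm (lp_sum a' b') (T x) / ns_norm (lp_sum a b) x"
  unfolding bounded_operatorsD(3)[OF T x]
    norm_lp_sum_scale[OF assms(1,2) bounded_operatorsD(1)[OF T x]] norm_of_real
  using norm_lp_sum_nonneg[of b a x] by simp

lemma min_modulus_mult_norm_le:
  assumes "0 < a" "0 < b" "0 < a'" "0 < b'"
    and T: "T \<in> bounded_operators (lp_sum a b) (lp_sum a' b')" and x: "x \<in> ns_carrier (lp_sum a b)"
  shows "min_modulus (lp_sum a b) (lp_sum a' b') T * ns_norm (lp_sum a b) x \<le> ns_norm (lp_sum a' b') (T x)"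
proof (cases "ns_norm (lp_sum a b) x = 0")
  case True
  then show ?thesis using norm_lp_sum_nonneg[of b' a' "T x"] by simp
next
  case False
  then have pos: "0 < ns_norm (lp_sum a b) x"
    using norm_lp_sum_nonneg[of b a x] by linarith
  have "min_modulus (lp_sum a b) (lp_sum a' b') T
      \<le> ns_norm (lp_sum a' b') (T x) / ns_norm (lp_sum a b) x"
    unfolding norm_image_normalize_lp_sum[OF assms(3,4) T x, symmetric]
    by (rule min_modulus_le_norm[OF normalize_lp_sum[OF assms(1,2) x False]])
  then show ?thesis using pos by (simp add: pos_le_divide_eq)
qed

section \<open>Property (m)\<close>

lemma property_m_lp_sum:
  fixes p q r s :: real
  assumes pqrs: "1 < p" "p \<le> r" "r \<le> s" "s \<le> q"
  shows "property_m (lp_sum s q :: ('k::{real_normed_field,heine_borel}, _) normed_space) (lp_sum r p)"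
  unfolding property_m_def operator_property_m_def
proof (intro ballI impI allI)
  let ?X = "lp_sum s q :: ('k, _) normed_space" and ?Y = "lp_sum r p :: ('k, _) normed_space"
  fix T x y u
  assume T: "T \<in> bounded_operators ?X ?Y" and m: "1 \<le> min_modulus ?X ?Y T"
    and x: "x \<in> ns_carrier ?X" and y: "y \<in> ns_carrier ?Y"
    and xy: "ns_norm ?X x \<le> ns_norm ?Y y" and null: "weakly_null ?X u"
  have pos: "0 < s" "0 < q" "0 < r" "0 < p" using pqrs by auto
  have u: "u n \<in> ns_carrier ?X" for n using null by (simp add: weakly_null_def)
  have Tu: "T (u n) \<in> ns_carrier ?Y" for n by (rule bounded_operatorsD(1)[OF T u])
  have yTu: "y + T (u n) \<in> ns_carrier ?Y" for n
    by (rule carrier_lp_sum_add[OF pos(3,4) y Tu])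
  have null_u: "coordinatewise_null u"
    by (rule weakly_null_coordinatewise_null[OF pos(1,2) id_bounded_operator null])
  have null_Tu: "coordinatewise_null (\<lambda>n. T (u n))"
    by (rule weakly_null_coordinatewise_null[OF pos(3,4) T null])
  have u_le: "ns_norm ?X (u n) \<le> ns_norm ?Y (T (u n))" for n
  proof -
    have "1 * ns_norm ?X (u n) \<le> min_modulus ?X ?Y T * ns_norm ?X (u n)"
      by (rule mult_right_mono[OF m norm_lp_sum_nonneg])
    also have "\<dots> \<le> ns_norm ?Y (T (u n))"
      by (rule min_modulus_mult_norm_le[OF pos T u])
    finally show ?thesis by simp
  qed
  let ?L = "limsup (\<lambda>n. ereal (ns_norm ?Y (y + T (u n))))"
  show "limsup (\<lambda>n. ereal (ns_norm ?X (x + u n))) \<le> ?L"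
  \<comment> \<open>An infinite right-hand side leaves nothing to prove. A finite one supplies the
    boundedness of \<open>T (u n)\<close>, and by \<open>u_le\<close> that of \<open>u n\<close>, so
    no uniform boundedness principle is invoked.\<close>
  proof (cases "?L = \<infinity>")
    case False
    have L0: "0 \<le> ?L"
      by (rule le_Limsup) (auto intro: always_eventually norm_lp_sum_nonneg)
    then obtain l where l: "?L = ereal l" "0 \<le> l"
      using False by (cases ?L) auto
    have lim: "\<forall>\<^sub>F n in sequentially. ns_norm ?Y (y + T (u n)) < l + e" if "0 < e" for e
    proof -
      have "?L < ereal (l + e)" using that by (simp add: l(1))
      from Limsup_lessD[OF this] show ?thesis by simp
    qed
    \<comment> \<open>\<open>T (u n)\<close> is the sum of \<open>y + T (u n)\<close>, whose norm is
      eventually below \<open>l + 1\<close>, and \<open>- y\<close>; \<open>R\<close> bounds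
      both.\<close>
    define R where "R = max (l + 1) (ns_norm ?Y y)"
    obtain K where K: "\<And>v w. v \<in> ns_carrier ?Y \<Longrightarrow> w \<in> ns_carrier ?Y \<Longrightarrow>
        ns_norm ?Y v \<le> R \<Longrightarrow> ns_norm ?Y w \<le> R \<Longrightarrow> ns_norm ?Y (v + w) \<le> K"
      by (rule norm_lp_sum_add_bounded[OF pos(3,4), of R, where 'k = 'k]) blast
    have bound_Tu: "\<forall>\<^sub>F n in sequentially. ns_norm ?Y (T (u n)) \<le> K"
      using lim[OF zero_less_one]
    proof eventually_elim
      case (elim n)
      have "ns_norm ?Y ((y + T (u n)) + (- y)) \<le> K"
        using elim by (intro K yTu carrier_lp_sum_minus y) (simp_all add: norm_lp_sum_minus R_def)
      then show ?case by simp
    qed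
    have bound_u: "\<forall>\<^sub>F n in sequentially. ns_norm ?X (u n) \<le> K"
      using bound_Tu by eventually_elim (rule order_trans[OF u_le])
    \<comment> \<open>The bound that results from chaining the lower estimate in \<open>?Y\<close>
      with the upper estimate in \<open>?X\<close>, each with error \<open>e\<close>. At
      \<open>e = 0\<close> the exponents cancel and leave \<open>l\<close>.\<close>
    define \<phi> where "\<phi> e = (((l + e) powr r + e) powr (s / r) + e) powr (1 / s)" for e
    have le_\<phi>: "limsup (\<lambda>n. ereal (ns_norm ?X (x + u n))) \<le> ereal (\<phi> e)" if e: "0 < e" for e
    proof (rule Limsup_bounded)
      note upper = norm_lp_sum_add_eventually_le[OF pos(1) pqrs(4) x u bound_u null_u e]
      note lower = norm_lp_sum_add_eventually_ge[OF pos(4) pqrs(2) y Tu bound_Tu null_Tu e]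
      from upper lower lim[OF e]
      show "\<forall>\<^sub>F n in sequentially. ereal (ns_norm ?X (x + u n)) \<le> ereal (\<phi> e)"
      proof eventually_elim
        case (elim n)
        have nn: "0 \<le> ns_norm ?X x" "0 \<le> ns_norm ?X (u n)" "0 \<le> ns_norm ?Y (y + T (u n))"
          by (rule norm_lp_sum_nonneg)+
        have pow: "z powr s = (z powr r) powr (s / r)" for z :: real
          using pos by (simp add: powr_powr)
        have "ns_norm ?X (x + u n) powr s \<le> ns_norm ?X x powr s + ns_norm ?X (u n) powr s + e"
          by (rule elim(1))
        \<comment> \<open>The passage from exponent \<open>s\<close> to exponent \<open>r\<close>;
          this is where \<open>r \<le> s\<close> enters.\<close>
        also have "ns_norm ?X x powr s + ns_norm ?X (u n) powr s
            \<le> (ns_norm ?X x powr r + ns_norm ?X (u n) powr r) powr (s / r)"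
          unfolding pow using pqrs pos by (intro powr_superadditive) auto
        also have "\<dots> \<le> ((l + e) powr r + e) powr (s / r)"
        proof (rule powr_mono2)
          have "ns_norm ?X x powr r + ns_norm ?X (u n) powr r
              \<le> ns_norm ?Y y powr r + ns_norm ?Y (T (u n)) powr r"
            using nn xy u_le[of n] pos by (intro add_mono powr_mono2) auto
          also have "\<dots> \<le> ns_norm ?Y (y + T (u n)) powr r + e" by (rule elim(2))
          also have "\<dots> \<le> (l + e) powr r + e"
            using nn elim(3) pos by (intro add_mono powr_mono2) auto
          finally show "ns_norm ?X x powr r + ns_norm ?X (u n) powr r \<le> (l + e) powr r + e" .
        qed (use pos in auto)
        finally have "ns_norm ?X (x + u n) powr s \<le> ((l + e) powr r + e) powr (s / r) + e" by simp
        from le_powr_inverse[OF pos(1) norm_lp_sum_nonneg this] show ?case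
          by (simp add: \<phi>_def)
      qed
    qed
    have "(\<phi> \<longlongrightarrow> (((l + 0) powr r + 0) powr (s / r) + 0) powr (1 / s)) (at_right 0)"
      unfolding \<phi>_def using pos l(2)
      by (intro tendsto_powr' tendsto_add tendsto_const tendsto_ident_at disjI2 conjI
          eventually_at_right_less[THEN eventually_mono] add_nonneg_nonneg powr_ge_zero) auto
    then have "(\<phi> \<longlongrightarrow> l) (at_right 0)"
      using pos l(2) by (simp add: powr_powr)
    then have "((\<lambda>e. ereal (\<phi> e)) \<longlongrightarrow> ereal l) (at_right 0)"
      by simp
    moreover have "\<forall>\<^sub>F e in at_right 0. limsup (\<lambda>n. ereal (ns_norm ?X (x + u n))) \<le> ereal (\<phi> e)"
      using eventually_at_right_less by (rule eventually_mono) (rule le_\<phi>)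
    ultimately show ?thesis
      unfolding l(1) by (rule tendsto_lowerbound) simp
  qed simp
qed

section \<open>The weak minimizing property\<close>

lemma frequently_imp_subsequence:
  assumes "\<exists>\<^sub>F n in sequentially. P n"
  obtains \<sigma> where "strict_mono (\<sigma> :: nat \<Rightarrow> nat)" "\<And>n. P (\<sigma> n)"
proof -
  have "infinite {n. P n}"
    using assms by (simp add: frequently_cofinite flip: cofinite_eq_sequentially)
  from infinite_enumerate[OF this] show thesis
    using that by blast
qed

lemma coordinatewise_null_subseq:
  assumes "coordinatewise_null u" "strict_mono \<sigma>"
  shows "coordinatewise_null (\<lambda>n. u (\<sigma> n))"
  using assms(1) LIMSEQ_subseq_LIMSEQ[OF _ assms(2), unfolded comp_def]
  unfolding coordinatewise_null_def by blast

lemma weak_minimizing_property_lp_sum: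
  fixes p q r s :: real
  assumes pqrs: "1 < p" "p \<le> r" "r \<le> s" "s \<le> q"
  shows "weak_minimizing_property
           (lp_sum s q :: ('k::{real_normed_field,heine_borel}, _) normed_space) (lp_sum r p)"
  unfolding weak_minimizing_property_def
proof (intro ballI impI, elim exE conjE)
  let ?X = "lp_sum s q :: ('k, _) normed_space" and ?Y = "lp_sum r p :: ('k, _) normed_space"
  fix T x
  assume T: "T \<in> bounded_operators ?X ?Y" and min: "minimizing_sequence ?X ?Y T x"
    and not_null: "\<not> weakly_null ?X x"
  define m where "m = min_modulus ?X ?Y T"
  have pos: "0 < s" "0 < q" "0 < r" "0 < p" using pqrs by auto
  have x: "x n \<in> ns_carrier ?X" and norm_x: "ns_norm ?X (x n) = 1" for n
    using min by (simp_all add: minimizing_sequence_def unit_sphere_def)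
  have lim_T: "(\<lambda>n. ns_norm ?Y (T (x n))) \<longlonglongrightarrow> m"
    using min by (simp add: minimizing_sequence_def m_def)
  obtain f where f: "f \<in> bounded_operators ?X scalar_space" and "\<not> (\<lambda>n. f (x n)) \<longlonglongrightarrow> 0"
    using not_null x unfolding weakly_null_def by blast
  then obtain \<epsilon> where \<epsilon>: "0 < \<epsilon>" and freq: "\<exists>\<^sub>F n in sequentially. \<epsilon> \<le> norm (f (x n))"
    unfolding tendsto_iff by (auto simp: not_eventually not_less)
  \<comment> \<open>Along \<open>\<sigma>1\<close> the functional \<open>f\<close> stays away from
    0, which later excludes a zero limit. The second extraction gives the coordinatewise limit
    \<open>z\<close>, the third the convergence of the norms of the remainder.\<close>
  obtain \<sigma>1 :: "nat \<Rightarrow> nat" where \<sigma>1: "strict_mono \<sigma>1" and f_ge: "\<And>n. \<epsilon> \<le> norm (f (x (\<sigma>1 n)))"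
    by (rule frequently_imp_subsequence[OF freq]) blast
  have bound1: "ns_norm ?X (x (\<sigma>1 n)) \<le> 1" for n
    by (simp add: norm_x)
  obtain \<sigma>2 :: "nat \<Rightarrow> nat" and z where \<sigma>2: "strict_mono \<sigma>2" and z: "z \<in> ns_carrier ?X"
    and null2: "coordinatewise_null (\<lambda>n. x (\<sigma>1 (\<sigma>2 n)) - z)"
    by (rule bounded_imp_coordinatewise_convergent_subsequence
        [of s q "\<lambda>n. x (\<sigma>1 n)" 1, OF pos(1,2) x bound1]) blast
  obtain K where K: "\<And>v w. v \<in> ns_carrier ?X \<Longrightarrow> w \<in> ns_carrier ?X \<Longrightarrow>
      ns_norm ?X v \<le> max 1 (ns_norm ?X z) \<Longrightarrow> ns_norm ?X w \<le> max 1 (ns_norm ?X z) \<Longrightarrow>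
      ns_norm ?X (v + w) \<le> K"
    by (rule norm_lp_sum_add_bounded[OF pos(1,2), of "max 1 (ns_norm ?X z)", where 'k = 'k]) blast
  have diff_le: "ns_norm ?X (x n - z) \<le> K" for n
    using K[OF x[of n] carrier_lp_sum_minus[OF z]] by (simp add: norm_x norm_lp_sum_minus)
  have "\<bar>ns_norm ?X (x (\<sigma>1 (\<sigma>2 n)) - z)\<bar> \<le> K" for n
    using diff_le norm_lp_sum_nonneg by (metis abs_of_nonneg)
  then have "bounded (range (\<lambda>n. ns_norm ?X (x (\<sigma>1 (\<sigma>2 n)) - z)))"
    unfolding bounded_iff by auto
  then obtain d and \<sigma>3 :: "nat \<Rightarrow> nat" where \<sigma>3: "strict_mono \<sigma>3"
    and d3: "((\<lambda>n. ns_norm ?X (x (\<sigma>1 (\<sigma>2 n)) - z)) \<circ> \<sigma>3) \<longlonglongrightarrow> d"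
    using bounded_imp_convergent_subsequence by blast
  define w where "w n = x (\<sigma>1 (\<sigma>2 (\<sigma>3 n)))" for n
  define v where "v n = w n - z" for n
  have w: "w n \<in> ns_carrier ?X" and norm_w: "ns_norm ?X (w n) = 1" for n
    by (simp_all only: w_def x norm_x)
  have v: "v n \<in> ns_carrier ?X" for n
    unfolding v_def by (rule carrier_lp_sum_diff[OF pos(1,2) w z])
  have zv: "z + v n = w n" for n by (simp add: v_def)
  have bound_v: "\<forall>\<^sub>F n in sequentially. ns_norm ?X (v n) \<le> K"
    unfolding v_def w_def by (intro always_eventually allI diff_le)
  have null_v: "coordinatewise_null v"
    using coordinatewise_null_subseq[OF null2 \<sigma>3] by (simp add: v_def[abs_def] w_def)
  have d: "(\<lambda>n. ns_norm ?X (v n)) \<longlonglongrightarrow> d"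
    using d3 by (simp add: v_def w_def comp_def)
  have d0: "0 \<le> d"
    by (rule LIMSEQ_le_const[OF d]) (auto intro: norm_lp_sum_nonneg)
  have weak_v: "weakly_null ?X v"
    unfolding weakly_null_def
    using v coordinatewise_null_bounded_functional[OF _ pqrs(4) v bound_v null_v] pqrs by auto
  have "strict_mono (\<sigma>1 \<circ> \<sigma>2 \<circ> \<sigma>3)"
    using \<sigma>1 \<sigma>2 \<sigma>3 by (simp add: strict_mono_o)
  from LIMSEQ_subseq_LIMSEQ[OF lim_T this]
  have lim_Tw: "(\<lambda>n. ns_norm ?Y (T (w n))) \<longlonglongrightarrow> m"
    by (simp add: comp_def w_def)
  \<comment> \<open>If \<open>z\<close> were 0, then \<open>w\<close> would equal the weakly null
    \<open>v\<close>, although \<open>f\<close> is at least \<open>\<epsilon>\<close> in norm along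
    \<open>w\<close>.\<close>
  have z_pos: "0 < ns_norm ?X z"
  proof (rule ccontr)
    assume "\<not> ?thesis"
    then have "ns_norm ?X z = 0" using norm_lp_sum_nonneg[of q s z] by linarith
    then have "fst z k = 0" "snd z k = 0" for k
      using norm_nth_le_norm_lp_sum[OF pos(1,2) z, of k] by simp_all
    then have "z = 0" by (auto simp: prod_eq_iff fun_eq_iff)
    then have "w = v" by (simp add: v_def fun_eq_iff)
    then have "(\<lambda>n. f (w n)) \<longlonglongrightarrow> 0" using weak_v f by (simp add: weakly_null_def)
    then have "\<forall>\<^sub>F n in sequentially. norm (f (w n)) < \<epsilon>"
      using \<epsilon> by (auto simp: tendsto_iff)
    then obtain n where "norm (f (w n)) < \<epsilon>"
      using eventually_happens by force
    with f_ge show False by (simp add: w_def not_less[symmetric])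
  qed
  have Tv: "T (v n) \<in> ns_carrier ?Y" for n by (rule bounded_operatorsD(1)[OF T v])
  have Tz: "T z \<in> ns_carrier ?Y" by (rule bounded_operatorsD(1)[OF T z])
  have Tw: "T (w n) = T z + T (v n)" for n
    using bounded_operatorsD(2)[OF T z v, of n] by (simp add: zv)
  obtain C where C: "\<And>x. x \<in> ns_carrier ?X \<Longrightarrow> ns_norm ?Y (T x) \<le> C * ns_norm ?X x"
    using bounded_operatorsD(4)[OF T] by blast
  have bound_Tv: "\<forall>\<^sub>F n in sequentially. ns_norm ?Y (T (v n)) \<le> \<bar>C\<bar> * K"
    using bound_v
  proof eventually_elim
    case (elim n)
    have "C * ns_norm ?X (v n) \<le> \<bar>C\<bar> * K"
      using elim by (intro mult_mono) (auto intro: norm_lp_sum_nonneg)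
    with C[OF v, of n] show ?case by linarith
  qed
  have null_Tv: "coordinatewise_null (\<lambda>n. T (v n))"
    by (rule weakly_null_coordinatewise_null[OF pos(3,4) T weak_v])
  have m0: "0 \<le> m"
    by (rule LIMSEQ_le_const[OF lim_Tw]) (auto intro: norm_lp_sum_nonneg)
  have ds: "(\<lambda>n. ns_norm ?X (v n) powr c) \<longlonglongrightarrow> d powr c" if "0 < c" for c
    using that by (intro tendsto_powr' d tendsto_const) (auto intro: always_eventually norm_lp_sum_nonneg)
  \<comment> \<open>The upper estimate for \<open>z + v n\<close>, whose norm is 1, in the
    limit.\<close>
  have upper: "1 \<le> ns_norm ?X z powr s + d powr s"
  proof (rule field_le_epsilon)
    fix e :: real assume e: "0 < e"
    have "(\<lambda>n. ns_norm ?X z powr s + ns_norm ?X (v n) powr s + e)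
        \<longlonglongrightarrow> ns_norm ?X z powr s + d powr s + e"
      by (intro tendsto_intros ds pos)
    moreover have "\<forall>\<^sub>F n in sequentially. 1 \<le> ns_norm ?X z powr s + ns_norm ?X (v n) powr s + e"
      using norm_lp_sum_add_eventually_le[OF pos(1) pqrs(4) z v bound_v null_v e]
      by (simp add: zv norm_w)
    ultimately show "1 \<le> ns_norm ?X z powr s + d powr s + e"
      by (rule tendsto_lowerbound) simp
  qed
  \<comment> \<open>The lower estimate for \<open>T z + T (v n)\<close>, whose norm tends to
    \<open>m\<close>, with \<open>T (v n)\<close> bounded below by \<open>m\<close> times the norm
    of \<open>v n\<close>.\<close>
  have lower: "ns_norm ?Y (T z) powr r + m powr r * d powr r \<le> m powr r"
  proof (rule field_le_epsilon)
    fix e :: real assume e: "0 < e"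
    have 1: "(\<lambda>n. ns_norm ?Y (T (w n)) powr r + e) \<longlonglongrightarrow> m powr r + e"
      using pos by (intro tendsto_add tendsto_powr' lim_Tw tendsto_const)
        (auto intro: always_eventually norm_lp_sum_nonneg)
    have 2: "(\<lambda>n. ns_norm ?Y (T z) powr r + m powr r * ns_norm ?X (v n) powr r)
        \<longlonglongrightarrow> ns_norm ?Y (T z) powr r + m powr r * d powr r"
      by (intro tendsto_intros ds pos)
    have "\<forall>\<^sub>F n in sequentially. ns_norm ?Y (T z) powr r + m powr r * ns_norm ?X (v n) powr r
        \<le> ns_norm ?Y (T (w n)) powr r + e"
      using norm_lp_sum_add_eventually_ge[OF pos(4) pqrs(2) Tz Tv bound_Tv null_Tv e]
    proof eventually_elim
      case (elim n)
      have "m powr r * ns_norm ?X (v n) powr r = (m * ns_norm ?X (v n)) powr r"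
        using m0 norm_lp_sum_nonneg by (subst powr_mult) auto
      also have "\<dots> \<le> ns_norm ?Y (T (v n)) powr r"
        using min_modulus_mult_norm_le[OF pos T v, of n] m0 pos
        by (intro powr_mono2) (auto simp: m_def intro!: mult_nonneg_nonneg norm_lp_sum_nonneg)
      finally show ?case using elim by (simp add: Tw)
    qed
    then show "ns_norm ?Y (T z) powr r + m powr r * d powr r \<le> m powr r + e"
      by (rule tendsto_le[OF _ 1 2, rotated]) simp
  qed
  \<comment> \<open>Transfers \<open>upper\<close> from exponent \<open>s\<close> to
    \<open>r\<close>: by superadditivity with exponent \<open>s / r\<close>, a sum below 1 here
    would force the sum in \<open>upper\<close> below 1.\<close>
  have "1 \<le> ns_norm ?X z powr r + d powr r"
  proof (rule ccontr)
    assume less: "\<not> ?thesis"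
    have pow: "t powr s = (t powr r) powr (s / r)" for t :: real
      using pos by (simp add: powr_powr)
    have "1 \<le> (ns_norm ?X z powr r + d powr r) powr (s / r)"
      using upper powr_superadditive[of "s / r" "ns_norm ?X z powr r" "d powr r"] pqrs pos
      unfolding pow by simp
    also have "\<dots> < 1 powr (s / r)"
      using less pos by (intro powr_less_mono2) (auto intro: add_nonneg_nonneg)
    finally show False by simp
  qed
  \<comment> \<open>Comparison with \<open>lower\<close> cancels \<open>m powr r * d powr r\<close>
    and leaves the norm of \<open>T z\<close> at most \<open>m\<close> times that of
    \<open>z\<close>.\<close>
  then have "m powr r \<le> m powr r * (ns_norm ?X z powr r + d powr r)"
    by (simp add: mult_le_cancel_left1)
  then have "ns_norm ?Y (T z) powr r \<le> m powr r * ns_norm ?X z powr r"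
    using lower by (simp add: distrib_left)
  also have "\<dots> = (m * ns_norm ?X z) powr r"
    using m0 z_pos by (simp add: powr_mult)
  finally have "ns_norm ?Y (T z) \<le> ((m * ns_norm ?X z) powr r) powr (1 / r)"
    by (rule le_powr_inverse[OF pos(3) norm_lp_sum_nonneg])
  then have le: "ns_norm ?Y (T z) / ns_norm ?X z \<le> m"
    using m0 z_pos pos by (simp add: powr_powr pos_divide_le_eq)
  have "ns_norm ?X z \<noteq> 0" using z_pos by simp
  note sphere = normalize_lp_sum[OF pos(1,2) z this]
  show "attains_min_modulus ?X ?Y T"
    unfolding attains_min_modulus_def
    using sphere
  proof (rule bexI[rotated], intro antisym)
    show "min_modulus ?X ?Y T \<le> ns_norm ?Y (T (ns_scale ?X (of_real (1 / ns_norm ?X z)) z))"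
      by (rule min_modulus_le_norm[OF sphere])
    show "ns_norm ?Y (T (ns_scale ?X (of_real (1 / ns_norm ?X z)) z)) \<le> min_modulus ?X ?Y T"
      unfolding norm_image_normalize_lp_sum[OF pos(3,4) T z] using le by (simp add: m_def)
  qed
qed

text \<open>The informal statement leaves the scalar field open, so it is asserted over the reals
  and over the complex numbers, both instances of the generic lemmas.\<close>

theorem mainTheorem3:
  fixes p q r s :: real
  assumes "1 < p" and "p \<le> r" and "r \<le> s" and "s \<le> q"
  shows
    "property_m (direct_sum q (lp TYPE(real) s) (lp TYPE(real) q))
                (direct_sum p (lp TYPE(real) r) (lp TYPE(real) p)) \<and>
     weak_minimizing_property (direct_sum q (lp TYPE(real) s) (lp TYPE(real) q))
                              (direct_sum p (lp TYPE(real) r) (lp TYPE(real) p)) \<and>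
     property_m (direct_sum q (lp TYPE(complex) s) (lp TYPE(complex) q))
                (direct_sum p (lp TYPE(complex) r) (lp TYPE(complex) p)) \<and>
     weak_minimizing_property (direct_sum q (lp TYPE(complex) s) (lp TYPE(complex) q))
                              (direct_sum p (lp TYPE(complex) r) (lp TYPE(complex) p))"
  by (intro conjI property_m_lp_sum[OF assms] weak_minimizing_property_lp_sum[OF assms])

end
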